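(* For all positive integers $r$ and $s$, the poset $P_{r,s}=[r]\oplus A_s\oplus[r]$ is a connected Peck poset, and $$\mathcal N_{P_{r,s}}(x)=(1+x)^s+2rx.$$ Moreover, if $s\ge6$ and $r>\frac{s(s-3)}4$, then $\mathcal N_{P_{r,s}}(x)$ is not unimodal.
   Context: $[r]$ is the $r$-element chain, $A_s$ is an antichain of cardinality $s$ (an $s$-element poset with no two distinct elements comparable), and $\oplus$ is the ordinal sum of posets. A poset is connected if its Hasse diagram is connected. The antichain polynomial of a finite poset $Q$ is $\mathcal N_Q(x)=\sum_{\mathcal A}x^{|\mathcal A|}$, the sum over all antichains $\mathcal A$ of $Q$ (including the empty set). A polynomial is unimodal if its coefficient sequence $(a_0,\dots,a_d)$ satisfies $a_0\le\cdots\le a_k\ge\cdots\ge a_d$ for some $k$. A finite graded poset, with rank levels $P_0,\dots,P_R$, is Peck if it is rank-symmetric ($|P_i|=|P_{R-i}|$ for all $i$), rank-unimodal (the sequence $|P_0|,\dots,|P_R|$ is unimodal), and strongly Sperner, meaning that for every positive integer $t$ the maximum cardinality of a union of $t$ antichains equals the sum of the $t$ largest rank numbers $|P_i|$ (the sum of all of them if $t>R+1$). *)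

theory Defs
  imports "HOL-Computational_Algebra.Polynomial"
begin

text \<open>A finite poset is given by its reflexive order relation \<open>r\<close> with \<open>Partial_order r\<close>;
  its set of elements is \<open>Field r\<close> and \<open>(x, y) \<in> r\<close> means \<open>x \<le> y\<close>.\<close>

definition ordinal_sum :: "'a rel \<Rightarrow> 'b rel \<Rightarrow> ('a + 'b) rel"  (infixr "\<oplus>\<^sub>P" 65) where
  "r \<oplus>\<^sub>P s = map_prod Inl Inl ` r \<union> map_prod Inr Inr ` s
            \<union> (Inl ` Field r) \<times> (Inr ` Field s)"

definition antichain_poset :: "nat \<Rightarrow> nat rel" where
  "antichain_poset s = Id_on {..<s}"

text \<open>\<open>natLeq_on r\<close> is the usual order on \<open>{0, \<dots>, r - 1}\<close>.\<close>

definition P_poset :: "nat \<Rightarrow> nat \<Rightarrow> (nat + nat + nat) rel" where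
  "P_poset r s = natLeq_on r \<oplus>\<^sub>P antichain_poset s \<oplus>\<^sub>P natLeq_on r"

definition cover_rel :: "'a rel \<Rightarrow> 'a rel" where
  "cover_rel r = {(x, y). (x, y) \<in> r \<and> x \<noteq> y \<and>
                    (\<forall>z. (x, z) \<in> r \<and> (z, y) \<in> r \<longrightarrow> z = x \<or> z = y)}"

definition connected_poset :: "'a rel \<Rightarrow> bool" where
  "connected_poset r \<longleftrightarrow> Partial_order r \<and> Field r \<noteq> {} \<and>
     (\<forall>x\<in>Field r. \<forall>y\<in>Field r. (x, y) \<in> (cover_rel r \<union> (cover_rel r)\<inverse>)\<^sup>*)"

definition antichain :: "'a rel \<Rightarrow> 'a set \<Rightarrow> bool" where
  "antichain r A \<longleftrightarrow> A \<subseteq> Field r \<and> (\<forall>x\<in>A. \<forall>y\<in>A. (x, y) \<in> r \<longrightarrow> x = y)"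

definition antichain_poly :: "'a rel \<Rightarrow> int poly" where
  "antichain_poly r = (\<Sum>A | antichain r A. monom 1 (card A))"

definition unimodal_seq :: "(nat \<Rightarrow> 'a::linorder) \<Rightarrow> nat \<Rightarrow> bool" where
  "unimodal_seq a d \<longleftrightarrow> (\<exists>k\<le>d. (\<forall>i<k. a i \<le> a (Suc i)) \<and>
                                (\<forall>i. k \<le> i \<and> i < d \<longrightarrow> a (Suc i) \<le> a i))"

definition unimodal_poly :: "int poly \<Rightarrow> bool" where
  "unimodal_poly p \<longleftrightarrow> unimodal_seq (coeff p) (degree p)"

definition maximal_chain :: "'a rel \<Rightarrow> 'a set \<Rightarrow> bool" where
  "maximal_chain r C \<longleftrightarrow> C \<in> Chains r \<and> (\<forall>D\<in>Chains r. C \<subseteq> D \<longrightarrow> D = C)"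

text \<open>\<open>r\<close> is finite and graded of rank \<open>R\<close>: all maximal chains have length \<open>R\<close>, i.e.\ \<open>R + 1\<close>
  elements. The rank function \<open>\<rho>\<close> is then determined uniquely on \<open>Field r\<close> by the last
  two conditions, with values in \<open>{0..R}\<close>.\<close>

definition graded_poset :: "'a rel \<Rightarrow> ('a \<Rightarrow> nat) \<Rightarrow> nat \<Rightarrow> bool" where
  "graded_poset r \<rho> R \<longleftrightarrow> Partial_order r \<and> finite (Field r) \<and>
     (\<forall>C. maximal_chain r C \<longrightarrow> card C = R + 1) \<and>
     (\<forall>x\<in>Field r. (\<forall>y. (y, x) \<in> r \<longrightarrow> y = x) \<longrightarrow> \<rho> x = 0) \<and>
     (\<forall>(x, y)\<in>cover_rel r. \<rho> y = \<rho> x + 1)"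

definition rank_number :: "'a rel \<Rightarrow> ('a \<Rightarrow> nat) \<Rightarrow> nat \<Rightarrow> nat" where
  "rank_number r \<rho> i = card {x \<in> Field r. \<rho> x = i}"

text \<open>Unions of \<open>t\<close> antichains are indexed by \<open>{..<t}\<close>, so that antichains may be empty or
  repeated; this matters when \<open>t\<close> is large. The function \<open>take\<close> returns the whole list
  when \<open>t > R + 1\<close>.\<close>

definition strongly_Sperner :: "'a rel \<Rightarrow> ('a \<Rightarrow> nat) \<Rightarrow> nat \<Rightarrow> bool" where
  "strongly_Sperner r \<rho> R \<longleftrightarrow>
     (\<forall>t>0. Max {card (\<Union>i<t. A i) | A. \<forall>i<t. antichain r (A i)} =
            sum_list (take t (rev (sort (map (rank_number r \<rho>) [0..<R + 1])))))"

definition Peck :: "'a rel \<Rightarrow> bool" where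
  "Peck r \<longleftrightarrow> (\<exists>\<rho> R. graded_poset r \<rho> R \<and>
     (\<forall>i\<le>R. rank_number r \<rho> i = rank_number r \<rho> (R - i)) \<and>
     unimodal_seq (rank_number r \<rho>) R \<and>
     strongly_Sperner r \<rho> R)"

end

theory Submission
  imports Defs
begin

text \<open>Comparability in \<open>[r] \<oplus> A\<^sub>s \<oplus> [r]\<close> depends only on the rank: distinct elements are comparable
  iff their ranks differ. Hence the nonempty antichains are the nonempty subsets of single rank
  levels, which gives both the antichain polynomial and the strong Sperner property (a union of
  \<open>t\<close> antichains lies in a union of \<open>t\<close> levels). Non-unimodality comes from the coefficients
  of degree 1, 2, 3, which are \<open>s + 2r > s(s-1)/2 < s(s-1)(s-2)/6\<close>.\<close>

section \<open>Sums of the largest values, and subsets counted by size\<close>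

text \<open>An exchange argument along the list: each step trades one element of \<open>T\<close>
  for the head of the list, whose value is at least as large.\<close>

lemma sum_le_sum_list_take:
  fixes f :: "'a \<Rightarrow> nat"
  assumes "distinct L" "sorted_wrt (\<lambda>x y. f y \<le> f x) L" "T \<subseteq> set L" "card T \<le> t"
  shows "sum f T \<le> sum_list (take t (map f L))"
  using assms
proof (induction L arbitrary: T t)
  case Nil
  then show ?case by simp
next
  case (Cons x L)
  have fin: "finite T" using Cons.prems(3) finite_subset by blast
  show ?case
  proof (cases "T = {}")
    case False
    \<comment> \<open>Choosing \<open>y = x\<close> whenever \<open>x\<close> lies in
      \<open>T\<close> ensures that \<open>T - {y}\<close> is contained in the tail, as the
      induction hypothesis requires.\<close>
    then obtain y where y: "y \<in> T" "x \<in> T \<longrightarrow> y = x" by blast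
    have "card T > 0" using False fin by (simp add: card_gt_0_iff)
    then obtain t' where t': "t = Suc t'" using Cons.prems(4) by (cases t) auto
    have "sum f (T - {y}) \<le> sum_list (take t' (map f L))"
    proof (rule Cons.IH)
      show "T - {y} \<subseteq> set L" using Cons.prems(3) y by auto
      show "card (T - {y}) \<le> t'" using Cons.prems(4) y t' fin by simp
    qed (use Cons.prems in auto)
    moreover have "f y \<le> f x" using Cons.prems y by auto
    ultimately show ?thesis using t' y fin by (simp add: sum.remove)
  qed simp
qed

text \<open>Sorting the indices by \<open>f\<close> instead of sorting the values keeps ties apart:
  the first \<open>t\<close> entries are distinct indices and form a set attaining the sum, and the
  exchange bound applies to any other set of at most \<open>t\<close> indices.\<close>

lemma
  fixes f :: "nat \<Rightarrow> nat"
  shows sum_largest_attained: "\<exists>T\<subseteq>{..R}. card T \<le> t \<and> sum f T = sum_list (take t (rev (sort (map f [0..<R + 1]))))"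
    and sum_le_sum_largest: "T \<subseteq> {..R} \<Longrightarrow> card T \<le> t \<Longrightarrow> sum f T \<le> sum_list (take t (rev (sort (map f [0..<R + 1]))))"
proof -
  define L where "L = rev (sort_key f [0..<R + 1])"
  have L: "distinct L" "set L = {..R}" unfolding L_def by (auto simp del: upt_Suc)
  have sorted: "sorted_wrt (\<lambda>x y. f y \<le> f x) L"
    unfolding L_def sorted_wrt_rev using sorted_sort_key[of f "[0..<R + 1]"]
    by (simp add: sorted_wrt_map del: upt_Suc)
  have map: "rev (sort (map f [0..<R + 1])) = map f L"
    unfolding L_def rev_map[symmetric] rev_is_rev_conv
    by (rule properties_for_sort) (simp_all del: upt_Suc)
  show "sum f T \<le> sum_list (take t (rev (sort (map f [0..<R + 1]))))"
    if "T \<subseteq> {..R}" "card T \<le> t"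
    unfolding map using sum_le_sum_list_take[OF L(1) sorted] that L(2) by simp
  have "sum f (set (take t L)) = sum_list (take t (map f L))"
    using L(1) by (simp add: sum_list_distinct_conv_sum_set take_map)
  moreover have "card (set (take t L)) \<le> t"
    using card_length[of "take t L"] by simp
  moreover have "set (take t L) \<subseteq> {..R}" using L(2) set_take_subset by metis
  ultimately show "\<exists>T\<subseteq>{..R}. card T \<le> t \<and> sum f T = sum_list (take t (rev (sort (map f [0..<R + 1]))))"
    unfolding map by blast
qed

text \<open>Subsets of \<open>insert a L\<close> split by whether they contain \<open>a\<close>;
  those that do contribute an extra factor x, so each new element multiplies the sum by 1 +
  x.\<close>

lemma sum_monom_card_Pow:
  assumes "finite L"
  shows "(\<Sum>A\<in>Pow L. monom 1 (card A)) = ([:1, 1:] :: int poly) ^ card L"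
  using assms
proof (induction L)
  case empty
  then show ?case by (simp add: one_pCons monom_0)
next
  case (insert a L)
  have "(\<Sum>A\<in>insert a ` Pow L. monom 1 (card A)) = (\<Sum>A\<in>Pow L. monom (1::int) (card (insert a A)))"
    using insert.hyps by (subst sum.reindex) (auto simp: inj_on_def)
  also have "\<dots> = (\<Sum>A\<in>Pow L. [:0, 1:] * monom 1 (card A))"
  proof (rule sum.cong)
    fix A assume "A \<in> Pow L"
    then have "finite A" "a \<notin> A" using insert.hyps finite_subset by auto
    then show "monom (1::int) (card (insert a A)) = [:0, 1:] * monom 1 (card A)"
      by (simp add: monom_Suc)
  qed simp
  also have "\<dots> = [:0, 1:] * [:1, 1:] ^ card L"
    by (simp only: sum_distrib_left[symmetric] insert.IH)
  finally have "(\<Sum>A\<in>Pow (insert a L). monom 1 (card A)) = [:1, 1:] ^ card L + [:0, 1:] * ([:1, 1:] :: int poly) ^ card L"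
    unfolding Pow_insert using insert by (subst sum.union_disjoint) auto
  also have "\<dots> = ([:1:] + [:0, 1:]) * [:1, 1:] ^ card L"
    by (simp add: distrib_right)
  finally show ?case using insert.hyps by simp
qed

section \<open>Posets whose order is determined by a rank function\<close>

text \<open>These are the finite ordinal sums of antichains. The last assumption makes each of the
  levels 0 to \<open>R\<close> nonempty, which forces covers to raise the rank by exactly
  one.\<close>

locale layered_poset =
  fixes Q :: "'a rel" and \<rho> :: "'a \<Rightarrow> nat" and R :: nat
  assumes finite_Field: "finite (Field Q)"
    and rel_iff: "(x, y) \<in> Q \<longleftrightarrow> x \<in> Field Q \<and> y \<in> Field Q \<and> (x = y \<or> \<rho> x < \<rho> y)"
    and image_rank: "\<rho> ` Field Q = {..R}"
begin

abbreviation level :: "nat \<Rightarrow> 'a set" where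
  "level i \<equiv> {x \<in> Field Q. \<rho> x = i}"

lemma rank_le: "x \<in> Field Q \<Longrightarrow> \<rho> x \<le> R"
  using image_rank by auto

lemma level_nonempty:
  assumes "i \<le> R"
  obtains x where "x \<in> Field Q" "\<rho> x = i"
proof -
  have "i \<in> \<rho> ` Field Q" using assms image_rank by simp
  then show thesis using that by auto
qed

lemma Partial_order: "Partial_order Q"
  unfolding partial_order_on_def preorder_on_def refl_on_def trans_def antisym_def
  by (auto simp: rel_iff)

text \<open>If the rank rises by more than one, an element of the nonempty level just above
  \<open>x\<close> lies strictly between \<open>x\<close> and \<open>y\<close>.\<close>

lemma cover_rel_iff: "(x, y) \<in> cover_rel Q \<longleftrightarrow> x \<in> Field Q \<and> y \<in> Field Q \<and> \<rho> y = \<rho> x + 1"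
proof
  assume cov: "(x, y) \<in> cover_rel Q"
  then have xy: "x \<in> Field Q" "y \<in> Field Q" "\<rho> x < \<rho> y"
    using rel_iff by (auto simp: cover_rel_def)
  have "\<rho> y = \<rho> x + 1"
  proof (rule ccontr)
    assume "\<rho> y \<noteq> \<rho> x + 1"
    then have lt: "\<rho> x + 1 < \<rho> y" using xy by simp
    then obtain z where z: "z \<in> Field Q" "\<rho> z = \<rho> x + 1"
      using level_nonempty[of "\<rho> x + 1"] rank_le[OF xy(2)] by auto
    then have "(x, z) \<in> Q" "(z, y) \<in> Q" using rel_iff xy lt by auto
    then show False using cov z lt by (auto simp: cover_rel_def)
  qed
  then show "x \<in> Field Q \<and> y \<in> Field Q \<and> \<rho> y = \<rho> x + 1" using xy by simp
next
  assume "x \<in> Field Q \<and> y \<in> Field Q \<and> \<rho> y = \<rho> x + 1"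
  then show "(x, y) \<in> cover_rel Q" unfolding cover_rel_def by (auto simp: rel_iff)
qed

text \<open>Everything is joined to one fixed element \<open>b\<close> of rank 0. The condition
  \<open>R > 0\<close> supplies a level above through which the other elements of rank 0 are
  reached; a single level with several elements would be disconnected.\<close>

lemma connected:
  assumes "R > 0"
  shows "connected_poset Q"
proof -
  let ?E = "(cover_rel Q \<union> (cover_rel Q)\<inverse>)\<^sup>*"
  have sym: "(y, x) \<in> ?E" if "(x, y) \<in> ?E" for x y
    using that sym_Un_converse[of "cover_rel Q"] by (meson sym_rtrancl symD)
  obtain b where b: "b \<in> Field Q" "\<rho> b = 0" using level_nonempty[of 0] by auto
  have up: "(b, x) \<in> ?E" if "x \<in> Field Q" "\<rho> x = Suc n" for x n
    using that
  proof (induction n arbitrary: x)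
    case 0
    then show ?case using b by (auto simp: cover_rel_iff)
  next
    case (Suc n)
    then obtain z where z: "z \<in> Field Q" "\<rho> z = Suc n"
      using level_nonempty[of "Suc n"] rank_le by (metis Suc_leD)
    then have "(z, x) \<in> cover_rel Q" using Suc by (simp add: cover_rel_iff)
    then show ?case using Suc.IH[OF z] by (meson UnI1 rtrancl.rtrancl_into_rtrancl)
  qed
  have all: "(b, x) \<in> ?E" if x: "x \<in> Field Q" for x
  proof (cases "\<rho> x")
    case 0
    obtain z where z: "z \<in> Field Q" "\<rho> z = Suc 0" using level_nonempty[of "Suc 0"] assms by auto
    \<comment> \<open>The path from \<open>b\<close> goes up to \<open>z\<close> of rank 1 and then
      down to \<open>x\<close>.\<close>
    then have "(x, z) \<in> cover_rel Q" using x 0 by (simp add: cover_rel_iff)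
    then show ?thesis using up[OF z]
      by (meson UnI2 converse_iff rtrancl.rtrancl_into_rtrancl)
  qed (use up x in auto)
  show ?thesis
    unfolding connected_poset_def
    using Partial_order b all sym by (metis empty_iff rtrancl_trans)
qed

text \<open>A maximal chain meets every level exactly once: at most once because distinct elements
  of equal rank are incomparable, and at least once because any element of a missed level is
  comparable to the whole chain and could be added.\<close>

lemma card_maximal_chain:
  assumes "maximal_chain Q C"
  shows "card C = R + 1"
proof -
  have C: "C \<in> Chains Q" and max: "\<And>D. D \<in> Chains Q \<Longrightarrow> C \<subseteq> D \<Longrightarrow> D = C"
    using assms by (auto simp: maximal_chain_def)
  have sub: "C \<subseteq> Field Q" using C by (auto simp: Chains_def Field_def)
  have inj: "inj_on \<rho> C"
    using C by (fastforce simp: inj_on_def Chains_def rel_iff)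
  have "i \<in> \<rho> ` C" if iR: "i \<le> R" for i
  proof (rule ccontr)
    assume i: "i \<notin> \<rho> ` C"
    obtain x where x: "x \<in> Field Q" "\<rho> x = i" using level_nonempty[OF iR] .
    have "(x, c) \<in> Q \<or> (c, x) \<in> Q" if "c \<in> C" for c
      using that x i sub by (auto simp: rel_iff) (metis image_eqI nat_neq_iff)
    moreover have "(x, x) \<in> Q" using x by (simp add: rel_iff)
    ultimately have "insert x C \<in> Chains Q" using C by (auto simp: Chains_def)
    then have "x \<in> C" using max[of "insert x C"] by auto
    then show False using i x by auto
  qed
  then have "\<rho> ` C = {..R}" using sub rank_le by auto
  then show ?thesis using card_image[OF inj] by simp
qed

lemma graded: "graded_poset Q \<rho> R"
proof -
  have "\<rho> x = 0" if x: "x \<in> Field Q" "\<forall>y. (y, x) \<in> Q \<longrightarrow> y = x" for x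
  proof (rule ccontr)
    assume "\<rho> x \<noteq> 0"
    moreover obtain y where "y \<in> Field Q" "\<rho> y = 0" using level_nonempty[of 0] by auto
    ultimately show False using x rel_iff[of y x] by auto
  qed
  then show ?thesis unfolding graded_poset_def
    using Partial_order finite_Field card_maximal_chain cover_rel_iff by auto
qed

lemma antichain_iff: "antichain Q A \<longleftrightarrow> (\<exists>i\<le>R. A \<subseteq> level i)"
proof
  assume A: "antichain Q A"
  show "\<exists>i\<le>R. A \<subseteq> level i"
  proof (cases "A = {}")
    case False
    then obtain a where a: "a \<in> A" by auto
    have "A \<subseteq> level (\<rho> a)"
    proof
      fix x assume x: "x \<in> A"
      have "\<rho> x = \<rho> a"
        using A x a unfolding antichain_def rel_iff by (metis nat_neq_iff subsetD)
      then show "x \<in> level (\<rho> a)" using A x by (auto simp: antichain_def)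
    qed
    then show ?thesis using rank_le A a by (meson antichain_def subsetD)
  qed auto
next
  assume "\<exists>i\<le>R. A \<subseteq> level i"
  then show "antichain Q A" unfolding antichain_def by (auto simp: rel_iff subset_iff)
qed

lemma card_Union_levels:
  assumes "finite T"
  shows "card (\<Union>i\<in>T. level i) = sum (rank_number Q \<rho>) T"
  unfolding rank_number_def using finite_Field assms by (subst card_UN_disjoint) auto

lemma strongly_Sperner: "strongly_Sperner Q \<rho> R"
  unfolding strongly_Sperner_def
proof (intro allI impI)
  fix t :: nat assume "t > 0"
  let ?M = "sum_list (take t (rev (sort (map (rank_number Q \<rho>) [0..<R + 1]))))"
  let ?S = "{card (\<Union>i<t. A i) | A. \<forall>i<t. antichain Q (A i)}"
  have le: "n \<le> ?M" if n: "n \<in> ?S" for n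
  proof -
    obtain A where A: "\<forall>i<t. antichain Q (A i)" "n = card (\<Union>i<t. A i)" using n by blast
    then obtain l where l: "\<And>i. i < t \<Longrightarrow> l i \<le> R \<and> A i \<subseteq> level (l i)"
      unfolding antichain_iff by metis
    \<comment> \<open>Several antichains may be assigned the same level, so \<open>l\<close> need
      not be injective; all that matters is that at most \<open>t\<close> levels occur.\<close>
    have "n \<le> card (\<Union>j\<in>l ` {..<t}. level j)"
      unfolding A(2) using l finite_Field by (intro card_mono) auto
    also have "\<dots> \<le> ?M" unfolding card_Union_levels[OF finite_imageI[OF finite_lessThan]]
      using l card_image_le[of "{..<t}" l] by (intro sum_le_sum_largest) auto
    finally show ?thesis .
  qed
  obtain T where T: "T \<subseteq> {..R}" "card T \<le> t" "sum (rank_number Q \<rho>) T = ?M"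
    using sum_largest_attained by blast
  have finT: "finite T" using T finite_subset by blast
  obtain h where h: "bij_betw h {0..<card T} T" using ex_bij_betw_nat_finite[OF finT] by auto
  \<comment> \<open>The best levels are enumerated by \<open>h\<close>. When fewer than
    \<open>t\<close> levels are used, the family is padded with empty antichains to length
    \<open>t\<close>.\<close>
  define A where "A i = (if i < card T then level (h i) else {})" for i
  have "\<forall>i<t. antichain Q (A i)"
    using h T(1) unfolding A_def antichain_iff by (fastforce simp: bij_betw_def)
  moreover have "(\<Union>i<t. A i) = (\<Union>j\<in>T. level j)"
  proof -
    have "(\<Union>i<t. A i) = (\<Union>i\<in>{0..<card T}. level (h i))"
      using T(2) unfolding A_def
      by (auto split: if_splits) (metis IntI lessThan_iff mem_Collect_eq order_less_le_trans)
    also have "\<dots> = (\<Union>j\<in>h ` {0..<card T}. level j)" by blast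
    finally show ?thesis using h by (simp only: bij_betw_def)
  qed
  ultimately have "?M \<in> ?S" using card_Union_levels[OF finT] T(3) by (auto intro!: exI[of _ A])
  \<comment> \<open>\<open>Max\<close> is meaningful only on a finite set; here the upper bound
    already gives finiteness.\<close>
  moreover have "finite ?S" using le finite_nat_set_iff_bounded_le by blast
  ultimately show "Max ?S = ?M" using le by (intro Max_eqI) auto
qed

text \<open>Nonempty antichains lie in exactly one level, so they are counted level by level. The
  empty set lies in every level: it is subtracted from each term and counted once by the leading
  1.\<close>

lemma antichain_poly:
  "antichain_poly Q = 1 + (\<Sum>i\<le>R. [:1, 1:] ^ rank_number Q \<rho> i - 1)"
proof -
  let ?N = "\<lambda>i. Pow (level i) - {{}}"
  have fin: "finite (?N i)" for i using finite_Field by simp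
  have N: "(\<Sum>A\<in>?N i. monom 1 (card A)) = ([:1, 1:] :: int poly) ^ rank_number Q \<rho> i - 1" for i
    using finite_Field
    by (subst sum_diff) (simp_all add: sum_monom_card_Pow rank_number_def one_pCons monom_0)
  have "{A. antichain Q A} = insert {} (\<Union>i\<in>{..R}. ?N i)"
    unfolding antichain_iff by auto
  moreover have "{} \<notin> (\<Union>i\<in>{..R}. ?N i)" "finite (\<Union>i\<in>{..R}. ?N i)"
    using fin by auto
  ultimately have "antichain_poly Q = 1 + (\<Sum>A\<in>(\<Union>i\<in>{..R}. ?N i). monom 1 (card A))"
    unfolding antichain_poly_def by (simp only: sum.insert not_False_eq_True card.empty monom_0 one_pCons)
  also have "(\<Sum>A\<in>(\<Union>i\<in>{..R}. ?N i). monom 1 (card A)) = (\<Sum>i\<le>R. \<Sum>A\<in>?N i. monom (1::int) (card A))"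
    using fin by (intro sum.UNION_disjoint) auto
  finally show ?thesis unfolding N .
qed

end

section \<open>Ordinal sums, chains and antichains as layered posets\<close>

lemma Field_ordinal_sum: "Field (Q \<oplus>\<^sub>P S) = Inl ` Field Q \<union> Inr ` Field S"
  unfolding ordinal_sum_def Field_def by force

text \<open>Ranks of the upper summand are shifted past the top rank \<open>R\<close> of the lower
  one, so that cross comparisons go strictly up in rank and the two ranges of ranks join without a
  gap.\<close>

lemma layered_poset_ordinal_sum:
  assumes "layered_poset Q \<rho> R" "layered_poset S \<sigma> R'"
  shows "layered_poset (Q \<oplus>\<^sub>P S) (case_sum \<rho> (\<lambda>y. R + 1 + \<sigma> y)) (R + 1 + R')"
proof -
  interpret Q: layered_poset Q \<rho> R by fact
  interpret S: layered_poset S \<sigma> R' by fact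
  show ?thesis
  proof
    show "finite (Field (Q \<oplus>\<^sub>P S))"
      by (simp add: Field_ordinal_sum Q.finite_Field S.finite_Field)
    fix x y
    have "(Inl a, Inl b) \<in> Q \<oplus>\<^sub>P S \<longleftrightarrow> (a, b) \<in> Q" for a b by (force simp: ordinal_sum_def)
    moreover have "(Inr a, Inr b) \<in> Q \<oplus>\<^sub>P S \<longleftrightarrow> (a, b) \<in> S" for a b by (force simp: ordinal_sum_def)
    moreover have "(Inl a, Inr b) \<in> Q \<oplus>\<^sub>P S \<longleftrightarrow> a \<in> Field Q \<and> b \<in> Field S" for a b
      by (force simp: ordinal_sum_def)
    moreover have "(Inr a, Inl b) \<notin> Q \<oplus>\<^sub>P S" for a b by (force simp: ordinal_sum_def)
    ultimately show "(x, y) \<in> Q \<oplus>\<^sub>P S \<longleftrightarrow> x \<in> Field (Q \<oplus>\<^sub>P S) \<and> y \<in> Field (Q \<oplus>\<^sub>P S) \<and>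
        (x = y \<or> case_sum \<rho> (\<lambda>y. R + 1 + \<sigma> y) x < case_sum \<rho> (\<lambda>y. R + 1 + \<sigma> y) y)"
      by (cases x; cases y)
        (auto simp: Field_ordinal_sum Q.rel_iff S.rel_iff image_iff dest: Q.rank_le)
  next
    have "{..R + 1 + R'} = {..R} \<union> (\<lambda>i. R + 1 + i) ` {..R'}"
      by (auto simp: image_iff) (metis Suc_leI add_Suc add_le_cancel_left atMost_iff le_Suc_ex not_le)
    then show "case_sum \<rho> (\<lambda>y. R + 1 + \<sigma> y) ` Field (Q \<oplus>\<^sub>P S) = {..R + 1 + R'}"
      by (simp add: Field_ordinal_sum image_Un image_image Q.image_rank flip: S.image_rank)
  qed
qed

lemma rank_number_ordinal_sum:
  assumes "layered_poset Q \<rho> R"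
  shows "rank_number (Q \<oplus>\<^sub>P S) (case_sum \<rho> (\<lambda>y. R + 1 + \<sigma> y)) i =
    (if i \<le> R then rank_number Q \<rho> i else rank_number S \<sigma> (i - (R + 1)))"
proof -
  interpret Q: layered_poset Q \<rho> R by fact
  have "{x \<in> Field (Q \<oplus>\<^sub>P S). case_sum \<rho> (\<lambda>y. R + 1 + \<sigma> y) x = i} =
    (if i \<le> R then Inl ` {x \<in> Field Q. \<rho> x = i} else Inr ` {y \<in> Field S. \<sigma> y = i - (R + 1)})"
    by (auto simp: Field_ordinal_sum dest: Q.rank_le)
  then show ?thesis unfolding rank_number_def by (simp add: card_image)
qed

lemma Field_natLeq_on: "Field (natLeq_on r) = {..<r}"
  unfolding Field_def by auto

lemma layered_poset_natLeq_on:
  assumes "r > 0"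
  shows "layered_poset (natLeq_on r) id (r - 1)"
  by unfold_locales (use assms in \<open>auto simp: Field_natLeq_on\<close>)

lemma rank_number_natLeq_on: "i < r \<Longrightarrow> rank_number (natLeq_on r) id i = 1"
proof -
  assume "i < r"
  then have "{x \<in> Field (natLeq_on r). id x = i} = {i}" by (auto simp: Field_natLeq_on)
  then show ?thesis by (simp add: rank_number_def)
qed

lemma Field_antichain_poset: "Field (antichain_poset s) = {..<s}"
  unfolding Field_def antichain_poset_def by auto

lemma layered_poset_antichain_poset:
  assumes "s > 0"
  shows "layered_poset (antichain_poset s) (\<lambda>_. 0) 0"
  by unfold_locales
    (use assms in \<open>auto simp: Field_antichain_poset\<close>, auto simp: antichain_poset_def)

lemma rank_number_antichain_poset: "rank_number (antichain_poset s) (\<lambda>_. 0) 0 = s"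
  by (simp add: rank_number_def Field_antichain_poset)

lemma P_poset_layered:
  assumes "r > 0" and "s > 0"
  obtains \<rho> where "layered_poset (P_poset r s) \<rho> (2 * r)"
    and "\<And>i. i \<le> 2 * r \<Longrightarrow> rank_number (P_poset r s) \<rho> i = (if i = r then s else 1)"
proof -
  note C = layered_poset_natLeq_on[OF assms(1)]
  note A = layered_poset_antichain_poset[OF assms(2)]
  \<comment> \<open>The terms \<open>0 + 1\<close> and \<open>r - 1 + 1\<close> stay unsimplified to
    match the rank function of \<open>layered_poset_ordinal_sum\<close>, applied first to the
    antichain and the upper chain, then to the lower chain and that sum.\<close>
  let ?\<sigma> = "case_sum (\<lambda>_::nat. 0) (\<lambda>y::nat. 0 + 1 + id y)"
  let ?\<rho> = "case_sum id (\<lambda>y. r - 1 + 1 + ?\<sigma> y)"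
  have "layered_poset (P_poset r s) ?\<rho> (r - 1 + 1 + (0 + 1 + (r - 1)))"
    unfolding P_poset_def
    by (rule layered_poset_ordinal_sum[OF C layered_poset_ordinal_sum[OF A C]])
  moreover have "r - 1 + 1 + (0 + 1 + (r - 1)) = 2 * r" using assms(1) by simp
  moreover have "rank_number (P_poset r s) ?\<rho> i = (if i = r then s else 1)" if "i \<le> 2 * r" for i
  proof -
    have "i < r \<or> i = r \<or> r < i" by auto
    then show ?thesis
      unfolding P_poset_def rank_number_ordinal_sum[OF C] rank_number_ordinal_sum[OF A]
      using that assms(1) rank_number_natLeq_on[of i r] rank_number_natLeq_on[of "i - r - 1" r]
        rank_number_antichain_poset[of s]
      by auto
  qed
  ultimately show thesis using that[of ?\<rho>] by metis
qed

section \<open>A strict valley in the coefficients\<close>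

lemma not_unimodal:
  assumes s: "s \<ge> 6" and r: "real r > real s * (real s - 3) / 4"
  shows "\<not> unimodal_poly ([:1, 1:] ^ s + [:0, 2 * int r:])"
proof
  let ?p = "[:1, 1:] ^ s + [:0, 2 * int r:]"
  assume "unimodal_poly ?p"
  then obtain k where up: "\<And>i. i < k \<Longrightarrow> coeff ?p i \<le> coeff ?p (Suc i)"
    and down: "\<And>i. k \<le> i \<Longrightarrow> i < degree ?p \<Longrightarrow> coeff ?p (Suc i) \<le> coeff ?p i"
    unfolding unimodal_poly_def unimodal_seq_def by blast
  have c1: "coeff ?p 1 = int s + 2 * int r"
    and c2: "coeff ?p 2 = int (s choose 2)"
    and c3: "coeff ?p 3 = int (s choose 3)"
    using s by (simp_all add: coeff_linear_poly_power[where a = 1 and b = 1] eval_nat_numeral)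
  have "real (s choose 2) = real s * (real s - 1) / 2"
    using s by (simp add: binomial_gbinomial gbinomial_prod_rev numeral_2_eq_2)
  \<comment> \<open>The inequality s(s-1)/2 < s + 2r rearranges to r > s(s-3)/4, which is the origin
    of the threshold.\<close>
  then have "real (s choose 2) < real (s + 2 * r)"
    using r by (simp add: field_simps)
  then have "coeff ?p 2 < coeff ?p 1" unfolding c1 c2 by linarith
  \<comment> \<open>Binomial coefficients increase strictly up to the middle, and
    \<open>s \<ge> 6\<close> places 3 in the lower half.\<close>
  moreover have "coeff ?p 2 < coeff ?p 3"
    unfolding c2 c3 using binomial_strict_mono[of 2 3 s] s by simp
  moreover have "3 \<le> degree ?p"
    using c3 s by (intro le_degree) simp
  \<comment> \<open>A peak at \<open>k \<ge> 2\<close> contradicts the descent from degree 1 to 2; a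
    peak at \<open>k < 2\<close> contradicts the ascent from degree 2 to 3.\<close>
  ultimately show False
    using up[of 1] down[of 2] by (cases "k \<ge> 2") (simp_all add: numeral_eq_Suc)
qed

section \<open>Level sizes 1, ..., 1, s, 1, ..., 1\<close>

theorem proposition5p2:
  fixes r s :: nat
  assumes "r > 0" and "s > 0"
  shows "connected_poset (P_poset r s) \<and> Peck (P_poset r s) \<and>
         antichain_poly (P_poset r s) = [:1, 1:] ^ s + [:0, 2 * int r:] \<and>
         (s \<ge> 6 \<and> real r > real s * (real s - 3) / 4 \<longrightarrow>
            \<not> unimodal_poly (antichain_poly (P_poset r s)))"
proof -
  obtain \<rho> where lay: "layered_poset (P_poset r s) \<rho> (2 * r)"
    and rank: "\<And>i. i \<le> 2 * r \<Longrightarrow> rank_number (P_poset r s) \<rho> i = (if i = r then s else 1)"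
    using P_poset_layered[OF assms] by blast
  interpret layered_poset "P_poset r s" \<rho> "2 * r" by fact
  have "unimodal_seq (rank_number (P_poset r s) \<rho>) (2 * r)"
    \<comment> \<open>The peak is the middle level \<open>r\<close>, of size
      \<open>s \<ge> 1\<close>, between levels of size 1.\<close>
    unfolding unimodal_seq_def using assms rank by (intro exI[of _ r]) auto
  moreover have "\<forall>i\<le>2 * r. rank_number (P_poset r s) \<rho> i = rank_number (P_poset r s) \<rho> (2 * r - i)"
    using rank by auto
  ultimately have Peck: "Peck (P_poset r s)"
    unfolding Peck_def using graded strongly_Sperner by blast
  have "(\<Sum>i\<le>2 * r. [:1, 1:] ^ rank_number (P_poset r s) \<rho> i - 1)
      = (\<Sum>i\<in>insert r ({..2 * r} - {r}). [:1, 1:] ^ (if i = r then s else 1) - (1 :: int poly))"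
    using rank by (intro sum.cong) auto
  \<comment> \<open>The middle level is split off; each of the remaining 2r singleton levels
    contributes (1 + x) - 1 = x.\<close>
  also have "\<dots> = ([:1, 1:] ^ s - 1) + of_nat (2 * r) * ([:1, 1:] - 1)"
    by (subst sum.insert) simp_all
  also have "of_nat (2 * r) * ([:1, 1:] - 1) = [:0, 2 * int r:]"
    by (simp add: of_nat_poly one_pCons)
  finally have poly: "antichain_poly (P_poset r s) = [:1, 1:] ^ s + [:0, 2 * int r:]"
    unfolding antichain_poly by simp
  show ?thesis
    using connected Peck poly not_unimodal assms by simp
qed

end
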